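(* For every $\delta>\tfrac34-\tfrac{\sqrt5}{4}$, no deterministic online algorithm for the Online Simple Knapsack problem with removability and item size estimates with additive accuracy $\delta$ has competitive ratio smaller than $\Phi=\frac{1+\sqrt5}{2}$.
   Context: Online Simple Knapsack with Removability and Item Size Estimates (additive accuracy $\delta\ge0$): an instance consists of actual sizes $x_1,\dots,x_n\in[0,1]$ and estimates $x_1',\dots,x_n'$ with $x_i'-\delta\le x_i\le x_i'+\delta$. A deterministic online algorithm knows $\delta$ and all estimates from the start; actual sizes are revealed one at a time. When $x_i$ is revealed, the algorithm may first permanently discard any subset of the items currently in its knapsack (capacity $1$), and then either pack $x_i$ (only if the current total plus $x_i$ is at most $1$) or reject it permanently. The gain is the total size in the knapsack at the end; $\mathrm{OPT}$ is the maximum total size of a subset of the actual items with sum at most $1$; the competitive ratio is the supremum of $\mathrm{OPT}/\mathrm{gain}$ over all instances with accuracy $\delta$. *)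

theory Defs
  imports Complex_Main "HOL-Library.Extended_Nonnegative_Real"
begin

(* Items are the positions 0, ..., length xs - 1 of the list xs of actual sizes;
   es is the list of estimates. *)

definition valid_instance :: "real \<Rightarrow> real list \<Rightarrow> real list \<Rightarrow> bool" where
  "valid_instance \<delta> es xs \<longleftrightarrow>
     length es = length xs \<and>
     (\<forall>i<length xs. xs ! i \<in> {0..1} \<and> es ! i - \<delta> \<le> xs ! i \<and> xs ! i \<le> es ! i + \<delta>)"

(* A deterministic strategy maps all estimates and the actual sizes revealed so far (the last
   one being that of the current item) to the set of items to discard and the decision whether
   to pack the current item. The knapsack content is determined by these data, so it is not
   a separate argument. Strategies are always considered for a given accuracy, on which
   they may therefore depend. *)
type_synonym strategy = "real list \<Rightarrow> real list \<Rightarrow> nat set \<times> bool"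

definition total_size :: "real list \<Rightarrow> nat set \<Rightarrow> real" where
  "total_size xs S = (\<Sum>i\<in>S. xs ! i)"

(* The content of the knapsack after the first k items have been processed. *)
primrec knapsack :: "strategy \<Rightarrow> real list \<Rightarrow> real list \<Rightarrow> nat \<Rightarrow> nat set" where
  "knapsack A es xs 0 = {}"
| "knapsack A es xs (Suc k) =
     (let (D, pack) = A es (take (Suc k) xs)
      in (knapsack A es xs k - D) \<union> (if pack then {k} else {}))"

definition online_algorithm :: "real \<Rightarrow> strategy \<Rightarrow> bool" where
  "online_algorithm \<delta> A \<longleftrightarrow>
     (\<forall>es xs. valid_instance \<delta> es xs \<longrightarrow>
        (\<forall>k<length xs.
           let (D, pack) = A es (take (Suc k) xs)
           in pack \<longrightarrow> total_size xs (knapsack A es xs k - D) + xs ! k \<le> 1))"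

definition gain :: "strategy \<Rightarrow> real list \<Rightarrow> real list \<Rightarrow> real" where
  "gain A es xs = total_size xs (knapsack A es xs (length xs))"

definition opt :: "real list \<Rightarrow> real" where
  "opt xs = Max {total_size xs S |S. S \<subseteq> {..<length xs} \<and> total_size xs S \<le> 1}"

(* In ennreal, a / 0 is infinite for a > 0, and 0 / 0 = 0. The latter convention is harmless:
   the instance with a single item of size and estimate 1 already makes the supremum at
   least 1 when \<delta> \<ge> 0. *)
definition competitive_ratio :: "real \<Rightarrow> strategy \<Rightarrow> ennreal" where
  "competitive_ratio \<delta> A =
     (SUP (es, xs) \<in> {(es, xs). valid_instance \<delta> es xs}. ennreal (opt xs) / ennreal (gain A es xs))"

end

theory Submission
  imports Defs
begin

text \<open>
  Let \<open>p = (sqrt 5 - 1) / 2\<close>, so \<open>p\<^sup>2 = 1 - p\<close> and the golden ratio is \<open>1 / p\<close>. For small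
  \<open>e > 0\<close> the adversary presents items of sizes \<open>1 - p + 2 e\<close> and \<open>p - e\<close>, which do not fit
  together. If the algorithm does not hold the first one, the third item \<open>p - 2 e\<close> completes the
  first one to \<open>1\<close>, while the algorithm ends with at most \<open>p\<close>. Otherwise the third item has size
  \<open>p\<close> and does not fit with the first one. If the algorithm now holds the third item, a fourth item
  \<open>1 - p + e\<close> completes the second one to \<open>1\<close> but does not fit with the third one; if not, the
  fourth item has size \<open>0\<close>, and the algorithm is left with \<open>1 - p + 2 e\<close> against \<open>p\<close>. The fourth
  item is the only one that needs a large uncertainty, namely \<open>2 \<delta> \<ge> 1 - p + e\<close>.
\<close>

lemma knapsack_subset: "knapsack A es xs k \<subseteq> {..<k}"
  by (induction k) (auto split: prod.splits)

lemma knapsack_Suc_subset: "knapsack A es xs (Suc k) \<subseteq> insert k (knapsack A es xs k)"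
  by (auto split: prod.splits if_splits)

text \<open>The strategy sees only the sizes revealed so far. This lets the adversary fix later
  sizes after observing the knapsack.\<close>

lemma knapsack_cong:
  assumes "take k xs = take k ys"
  shows "knapsack A es xs k = knapsack A es ys k"
  using assms
proof (induction k)
  case (Suc k)
  have "take k xs = take k (take (Suc k) xs)" by (simp add: min_def)
  also have "\<dots> = take k (take (Suc k) ys)" using Suc.prems by simp
  also have "\<dots> = take k ys" by (simp add: min_def)
  finally show ?case using Suc by simp
qed simp

lemma total_size_mono:
  assumes "valid_instance \<delta> es xs" "S \<subseteq> T" "T \<subseteq> {..<length xs}"
  shows "total_size xs S \<le> total_size xs T"
  unfolding total_size_def
  using assms by (intro sum_mono2) (auto simp: valid_instance_def intro: finite_subset)

text \<open>\<open>online_algorithm\<close> checks the capacity only when an item is packed.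
  Discarding cannot raise the total, as sizes are nonnegative.\<close>

lemma total_size_knapsack_le_1:
  assumes "online_algorithm \<delta> A" "valid_instance \<delta> es xs" "k \<le> length xs"
  shows "total_size xs (knapsack A es xs k) \<le> 1"
  using assms(3)
proof (induction k)
  case (Suc k)
  obtain D b where Db: "A es (take (Suc k) xs) = (D, b)" by fastforce
  let ?K = "knapsack A es xs k"
  have sub: "?K - D \<subseteq> {..<k}" using knapsack_subset[of A es xs k] by auto
  show ?case
  proof (cases b)
    case True
    have "total_size xs (?K - D) + xs ! k \<le> 1"
      using assms(1)[unfolded online_algorithm_def, rule_format, OF assms(2), of k] Suc.prems Db True
      by simp
    moreover have "finite (?K - D)" "k \<notin> ?K - D" using sub by (auto intro: finite_subset)
    ultimately show ?thesis using Db True by (simp add: total_size_def)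
  next
    case False
    have "total_size xs (?K - D) \<le> total_size xs ?K"
      using Suc.prems knapsack_subset[of A es xs k] by (intro total_size_mono[OF assms(2)]) auto
    then show ?thesis using Db False Suc by simp
  qed
qed (simp add: total_size_def)

lemma knapsack_pair_le_1:
  assumes "online_algorithm \<delta> A" "valid_instance \<delta> es xs" "k \<le> length xs"
    and "i \<in> knapsack A es xs k" "j \<in> knapsack A es xs k" "i \<noteq> j"
  shows "xs ! i + xs ! j \<le> 1"
proof -
  have "total_size xs {i, j} \<le> total_size xs (knapsack A es xs k)"
    using assms(3-5) knapsack_subset[of A es xs k] by (intro total_size_mono[OF assms(2)]) auto
  then show ?thesis
    using total_size_knapsack_le_1[OF assms(1-3)] assms(6) by (simp add: total_size_def)
qed

lemma total_size_le_opt: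
  assumes "S \<subseteq> {..<length xs}" "total_size xs S \<le> 1"
  shows "total_size xs S \<le> opt xs"
proof -
  have "finite {total_size xs S |S. S \<subseteq> {..<length xs} \<and> total_size xs S \<le> 1}"
    by (rule finite_subset[of _ "total_size xs ` Pow {..<length xs}"]) auto
  then show ?thesis unfolding opt_def using assms by (intro Max_ge) auto
qed

lemma inverse_antimono_ennreal: "a \<le> b \<Longrightarrow> inverse b \<le> inverse (a :: ennreal)"
  by (simp add: less_eq_ennreal.rep_eq inverse_ennreal.rep_eq ereal_inverse_antimono)

text \<open>The gain enters only through a positive upper bound \<open>g\<close>, so a gain of zero,
  where the quotient may be infinite, needs no separate case.\<close>

lemma competitive_ratio_ge:
  assumes "valid_instance \<delta> es xs" "gain A es xs \<le> g" "0 < g" "0 \<le> r"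
    and "S \<subseteq> {..<length xs}" "total_size xs S \<le> 1" "r * g \<le> total_size xs S"
  shows "ennreal r \<le> competitive_ratio \<delta> A"
proof -
  have "r * g \<le> opt xs" using total_size_le_opt[OF assms(5,6)] assms(7) by simp
  then have "r \<le> opt xs / g" using assms(3) by (simp add: field_simps)
  moreover have "0 \<le> opt xs"
    using \<open>r * g \<le> opt xs\<close> assms(3,4) by (meson mult_nonneg_nonneg less_imp_le order_trans)
  ultimately have "ennreal r \<le> ennreal (opt xs) / ennreal g"
    using assms(3) by (simp add: divide_ennreal ennreal_leI)
  also have "\<dots> \<le> ennreal (opt xs) / ennreal (gain A es xs)"
    unfolding divide_ennreal_def
    by (intro mult_left_mono inverse_antimono_ennreal ennreal_leI assms(2)) simp
  also have "\<dots> \<le> competitive_ratio \<delta> A"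
    unfolding competitive_ratio_def by (rule SUP_upper2[of "(es, xs)"]) (use assms(1) in auto)
  finally show ?thesis .
qed

lemma competitive_ratio_ge_adversary:
  fixes p e \<delta> :: real
  assumes alg: "online_algorithm \<delta> A" and p: "p * p = 1 - p" "3 / 5 < p" "p < 2 / 3"
    and e: "0 < e" "e < 1 / 20" and \<delta>: "1 - p + e \<le> 2 * \<delta>"
  shows "ennreal (p / (1 - p + 2 * e)) \<le> competitive_ratio \<delta> A"
proof -
  \<comment> \<open>The first two estimates are exact. The other two are midpoints: of
    \<open>p - 2 * e\<close> and \<open>p\<close>, and of \<open>0\<close> and
    \<open>1 - p + e\<close>.\<close>
  define es where "es = [1 - p + 2 * e, p - e, p - e, (1 - p + e) / 2]"
  define inst where "inst y z = [1 - p + 2 * e, p - e, y, z]" for y z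
  define r where "r = p / (1 - p + 2 * e)"
  have len: "length (inst y z) = 4" for y z by (simp add: inst_def)
  have nth: "inst y z ! 0 = 1 - p + 2 * e" "inst y z ! Suc 0 = p - e"
    "inst y z ! 2 = y" "inst y z ! 3 = z" for y z
    by (auto simp: inst_def)
  have valid: "valid_instance \<delta> es (inst y z)"
    if "y \<in> {p, p - 2 * e}" "z \<in> {0, 1 - p + e}" for y z
    using that p e \<delta> by (auto simp: valid_instance_def es_def inst_def less_Suc_eq field_simps)
  have r: "0 \<le> r" "r * (1 - p + 2 * e) = p" using p e by (auto simp: r_def)
  \<comment> \<open>Since \<open>p * p = 1 - p\<close>, the value \<open>p\<close> is at most
    \<open>(1 - p + 2 * e) / p\<close>. Hence gain \<open>p\<close> against optimum 1 also yields
    ratio \<open>r\<close>.\<close>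
  have "r * p \<le> r * ((1 - p + 2 * e) / p)"
    using p e r by (intro mult_left_mono) (auto simp: field_simps)
  also have "\<dots> = 1" using r p by simp
  finally have rp: "r * p \<le> 1" .
  let ?K = "\<lambda>y z k. knapsack A es (inst y z) k"
  have step: "?K y z 3 \<subseteq> insert 2 (?K y z 2)" "?K y z 4 \<subseteq> insert 3 (?K y z 3)" for y z
    using knapsack_Suc_subset[of A es "inst y z" 2] knapsack_Suc_subset[of A es "inst y z" 3]
    by (simp_all add: eval_nat_numeral)
  have K2: "?K y z 2 \<subseteq> {0, 1}" for y z
    using knapsack_subset[of A es "inst y z" 2] by auto
  have K2_cong: "?K y z 2 = ?K y' z' 2" for y z y' z'
    by (rule knapsack_cong) (simp add: inst_def)
  have K3_cong: "?K y z 3 = ?K y z' 3" for y z z'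
    by (rule knapsack_cong) (simp add: inst_def)
  have pair: "inst y z ! i + inst y z ! j \<le> 1"
    if "y \<in> {p, p - 2 * e}" "z \<in> {0, 1 - p + e}" "k \<le> 4" "i \<in> ?K y z k" "j \<in> ?K y z k" "i \<noteq> j"
    for y z k i j
    using knapsack_pair_le_1[OF alg valid[OF that(1,2)]] that by (simp add: len)
  have gain_le: "gain A es (inst y z) \<le> total_size (inst y z) T"
    if "y \<in> {p, p - 2 * e}" "z \<in> {0, 1 - p + e}" "?K y z 4 \<subseteq> T" "T \<subseteq> {..<4}" for y z T
    using total_size_mono[OF valid[OF that(1,2)]] that by (simp add: gain_def len)
  have "ennreal r \<le> competitive_ratio \<delta> A"
  \<comment> \<open>The sizes \<open>p\<close> and \<open>0\<close> are placeholders here: by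
    \<open>K2_cong\<close> the state after two items does not depend on them.\<close>
  proof (cases "0 \<in> ?K p 0 2")
    case False
    let ?y = "p - 2 * e" and ?z = "0 :: real"
    have "0 \<notin> ?K ?y ?z 2" using False K2_cong by blast
    then have "?K ?y ?z 4 \<subseteq> {1, 2, 3}" using K2[of ?y ?z] step[of ?y ?z] by auto
    \<comment> \<open>These items total \<open>2 * p - 3 * e\<close>, which exceeds 1 by the numeric
      bounds on \<open>p\<close> and \<open>e\<close>.\<close>
    moreover have "\<not> (1 \<in> ?K ?y ?z 4 \<and> 2 \<in> ?K ?y ?z 4)"
      using pair[of ?y ?z 4 1 2] p e by (auto simp: nth)
    ultimately consider "?K ?y ?z 4 \<subseteq> {1, 3}" | "?K ?y ?z 4 \<subseteq> {2, 3}" by blast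
    then have "gain A es (inst ?y ?z) \<le> p"
    proof cases
      case 1
      then show ?thesis using gain_le[of ?y ?z "{1, 3}"] e by (simp add: total_size_def nth)
    next
      case 2
      then show ?thesis using gain_le[of ?y ?z "{2, 3}"] e by (simp add: total_size_def nth)
    qed
    then show ?thesis
      using valid[of ?y ?z] r rp p
      by (intro competitive_ratio_ge[of \<delta> es "inst ?y ?z" A p r "{0, 2}"])
         (auto simp: len total_size_def nth)
  next
    case True
    have not1: "1 \<notin> ?K p z 2" if "z \<in> {0, 1 - p + e}" for z
    proof
      assume "1 \<in> ?K p z 2"
      moreover have "0 \<in> ?K p z 2" using True K2_cong by blast
      ultimately show False using pair[of p z 2 0 1] that e by (auto simp: nth)
    qed
    show ?thesis
    \<comment> \<open>Again \<open>0\<close> is a placeholder for the unrevealed fourth size, by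
      \<open>K3_cong\<close>.\<close>
    proof (cases "2 \<in> ?K p 0 3")
      case True
      let ?z = "1 - p + e"
      have "2 \<in> ?K p ?z 3" using True K3_cong by blast
      then have "0 \<notin> ?K p ?z 3" using pair[of p ?z 3 0 2] e by (auto simp: nth)
      moreover have "1 \<notin> ?K p ?z 3" using not1[of ?z] step(1)[of p ?z] by auto
      ultimately have "?K p ?z 4 \<subseteq> {2, 3}" using K2[of p ?z] step[of p ?z] by auto
      moreover have "\<not> (2 \<in> ?K p ?z 4 \<and> 3 \<in> ?K p ?z 4)"
        using pair[of p ?z 4 2 3] e by (auto simp: nth)
      ultimately consider "?K p ?z 4 \<subseteq> {2}" | "?K p ?z 4 \<subseteq> {3}" by blast
      then have "gain A es (inst p ?z) \<le> p"
      proof cases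
        case 1
        then show ?thesis using gain_le[of p ?z "{2}"] by (simp add: total_size_def nth)
      next
        case 2
        then show ?thesis using gain_le[of p ?z "{3}"] p e by (simp add: total_size_def nth)
      qed
      then show ?thesis
        using valid[of p ?z] r rp p
        by (intro competitive_ratio_ge[of \<delta> es "inst p ?z" A p r "{1, 3}"])
           (auto simp: len total_size_def nth)
    next
      case False
      \<comment> \<open>Item 1 is already lost and item 2 is not held; item 3 has size 0, so only
        item 0 can contribute.\<close>
      then have "?K p 0 4 \<subseteq> {0, 3}" using not1[of 0] K2[of p 0] step[of p 0] by auto
      then have "gain A es (inst p 0) \<le> 1 - p + 2 * e"
        using gain_le[of p 0 "{0, 3}"] by (simp add: total_size_def nth)
      then show ?thesis
        using valid[of p 0] r p e
        by (intro competitive_ratio_ge[of \<delta> es "inst p 0" A "1 - p + 2 * e" r "{2}"])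
           (auto simp: len total_size_def nth)
    qed
  qed
  then show ?thesis by (simp add: r_def)
qed

theorem theorem17:
  fixes \<delta> :: real
  assumes "\<delta> > 3 / 4 - sqrt 5 / 4"
  shows "\<not> (\<exists>A. online_algorithm \<delta> A \<and> competitive_ratio \<delta> A < ennreal ((1 + sqrt 5) / 2))"
proof
  assume "\<exists>A. online_algorithm \<delta> A \<and> competitive_ratio \<delta> A < ennreal ((1 + sqrt 5) / 2)"
  then obtain A where A: "online_algorithm \<delta> A"
    and less: "competitive_ratio \<delta> A < ennreal ((1 + sqrt 5) / 2)" by blast
  define p :: real where "p = (sqrt 5 - 1) / 2"
  have pp: "p * p = 1 - p" by (simp add: p_def field_simps)
  have "11 / 5 < sqrt 5" "sqrt 5 < 7 / 3"
    by (rule real_less_rsqrt real_less_lsqrt; simp add: power2_eq_square)+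
  then have p: "3 / 5 < p" "p < 2 / 3" by (auto simp: p_def)
  \<comment> \<open>The threshold on \<open>\<delta>\<close> is exactly \<open>(1 - p) / 2\<close>;
    the strict inequality leaves room for a positive \<open>e\<close>.\<close>
  have "1 - p < 2 * \<delta>" using assms by (simp add: p_def field_simps)
  define m where "m = min (1 / 20) (2 * \<delta> - (1 - p))"
  have "0 < m" using \<open>1 - p < 2 * \<delta>\<close> by (simp add: m_def)
  \<comment> \<open>Each single \<open>e\<close> gives a bound strictly below the golden ratio, so
    the limit from the right at 0 is needed.\<close>
  have "((\<lambda>e. p / (1 - p + 2 * e)) \<longlongrightarrow> p / (1 - p + 2 * 0)) (at_right 0)"
    using p by (intro tendsto_intros) auto
  then have "((\<lambda>e. ennreal (p / (1 - p + 2 * e))) \<longlongrightarrow> ennreal (p / (1 - p))) (at_right 0)"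
    by (intro tendsto_ennrealI) simp
  moreover have "eventually (\<lambda>e. ennreal (p / (1 - p + 2 * e)) \<le> competitive_ratio \<delta> A) (at_right 0)"
    using eventually_at_right_real[OF \<open>0 < m\<close>]
    by eventually_elim
       (auto intro!: competitive_ratio_ge_adversary[OF A pp p] simp: m_def)
  ultimately have "ennreal (p / (1 - p)) \<le> competitive_ratio \<delta> A"
    by (rule tendsto_upperbound) simp
  moreover have "p / (1 - p) = (1 + sqrt 5) / 2"
  proof -
    have "p / (1 - p) = 1 / p" using p by (simp flip: pp)
    also have "\<dots> = (1 + sqrt 5) / 2"
      using p pp by (simp add: field_simps) (simp add: p_def field_simps)
    finally show ?thesis .
  qed
  ultimately show False using less by simp
qed

end
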